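(* Let $G = \langle [n],\pi,\mathcal{M},\{\beta_\sigma\}_{\sigma\in\Sigma}\rangle$ be (the algebraic representation of) an unambiguous context-free grammar in Chomsky form and let $A' = \langle[n'],\pi',\{A'_\sigma\}_{\sigma\in\Sigma}\rangle$ be an HMM over the same finite alphabet $\Sigma$. For an integer $L\ge 1$ put $$\beta_{G,A'}^{(L)} = \sum_{w\in\Sigma^L}\beta_G(w)\otimes \mathrm{vec}(A'_w)\in\mathbb{R}^{n\cdot n'^2}.$$ Let $\phi(i,j)=(j-1)n'+i$ for $(i,j)\in[n']^2$ and let $\mathcal{T}\in\mathbb{R}^{n'^2\times n'^2\times n'^2}$ be the tensor with $\mathcal{T}[\phi(i_1,j_1),\phi(i_2,j_2),\phi(i_3,j_3)]=1$ if $i_1=i_2$, $j_1=j_3$ and $j_2=i_3$, and $0$ otherwise. Let $P\in\mathbb{R}^{n'^4n^2\times n'^4n^2}$ be the permutation matrix determined by $$P\cdot\big(e_i^{(n)}\otimes e_j^{(n'^2)}\otimes e_k^{(n)}\otimes e_l^{(n'^2)}\big)=e_i^{(n)}\otimes e_k^{(n)}\otimes e_j^{(n'^2)}\otimes e_l^{(n'^2)}$$ for all $(i,j,k,l)\in[n]\times[n'^2]\times[n]\times[n'^2]$. Then: 1. $\beta_{G,A'}^{(1)}=\sum_{\sigma\in\Sigma}\beta_\sigma\otimes \mathrm{vec}(A'_\sigma)$; 2. for every integer $L>1$, $$\beta_{G,A'}^{(L)}=(\mathcal{M}\otimes\mathcal{T})_1\cdot P\cdot\sum_{i=1}^{L-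1}\big(\beta_{G,A'}^{(i)}\otimes\beta_{G,A'}^{(L-i)}\big).$$
   Context: For an integer $m>0$, $[m]=\{1,\dots,m\}$; $e_i^{(m)}$ is the $i$-th standard basis vector of $\mathbb{R}^m$; $\otimes$ is the Kronecker product. For $A\in\mathbb{R}^{m\times m}$, $\mathrm{vec}(A)\in\mathbb{R}^{m^2}$ stacks the columns of $A$, so $\mathrm{vec}(A)[(j-1)m+i]=A[i,j]$. For a tensor $\mathcal{S}\in\mathbb{R}^{m\times m\times m}$, its mode-1 matricization $\mathcal{S}_1\in\mathbb{R}^{m\times m^2}$ has as column of index $(b-1)m+c$ the vector $\mathcal{S}[:,b,c]$, so that $(\mathcal{S}_1(v\otimes v'))[a]=\sum_{b,c}\mathcal{S}[a,b,c]v[b]v'[c]$. For two order-3 tensors, $(\mathcal{M}\otimes\mathcal{T})_1$ denotes the matrix $\mathcal{M}_1\otimes\mathcal{T}_1$. CFG: a context-free grammar in Chomsky form has nonterminals $[n]$, terminal alphabet $\Sigma$, initial nonterminal $S\in[n]$, and a finite set $R$ of rules of the form $i\to jk$ or $i\to\sigma$ with $i,j,k\in[n]$, $\sigma\in\Sigma$. Its algebraic representation is $\langle[n],\pi,\mathcal{M},\{\beta_\sigma\}_{\sigma\in\Sigma}\rangle$ where $\pi=e_S^{(n)}$; $\mathcal{M}\in\mathbb{R}^{n\times n\times n}$ has $\mathcal{M}[i,j,k]=1$ if $(i\to jk)\in R$ and $0$ otherwise; $\beta_\sigma\in\mathbb{R}^n$ has $\beta_\sigma[i]=1$ if $(i\to\sigma)\in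 R$ and $0$ otherwise. For nonempty $w\in\Sigma^*$, $\beta_G(w)\in\mathbb{R}^n$ is the vector whose $i$-th entry is the number of derivation trees with root labelled $i$ and yield $w$; thus $\beta_G(\sigma)=\beta_\sigma$ for a letter $\sigma$, and $\beta_G(w)=\mathcal{M}_1\cdot\sum_{w_1w_2=w,\ w_1,w_2\in\Sigma^+}\beta_G(w_1)\otimes\beta_G(w_2)$ for $|w|\ge2$. Put $f_G(w)=\pi^T\beta_G(w)$, the number of derivation trees of $w$ rooted at $S$. $G$ is unambiguous if $f_G(w)\le1$ for all $w$. HMM: $A'=\langle[n'],\pi',\{A'_\sigma\}_{\sigma\in\Sigma}\rangle$ with $\pi'$ a probability distribution over $[n']$ and entrywise non-negative matrices $A'_\sigma\in\mathbb{R}^{n'\times n'}$ such that $\sum_\sigma A'_\sigma$ has all row sums equal to $1$. For $w=w_1\cdots w_m$ (letters), $A'_w=A'_{w_1}\cdots A'_{w_m}$. *)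

theory Defs
  imports "Jordan_Normal_Form.Matrix"
begin

(* All indices are zero-based: [m] is {..<m}, and an index (j - 1) m + i of the one-based
   convention becomes j m + i. *)

section \<open>Kronecker products, vectorization and matricization\<close>

definition kron_vec :: "'a :: times vec \<Rightarrow> 'a vec \<Rightarrow> 'a vec" (infixl "\<otimes>\<^sub>v" 75) where
  "v \<otimes>\<^sub>v w = vec (dim_vec v * dim_vec w)
     (\<lambda>p. v $ (p div dim_vec w) * w $ (p mod dim_vec w))"

definition kron_mat :: "'a :: times mat \<Rightarrow> 'a mat \<Rightarrow> 'a mat" (infixl "\<otimes>\<^sub>m" 75) where
  "A \<otimes>\<^sub>m B = mat (dim_row A * dim_row B) (dim_col A * dim_col B)
     (\<lambda>(p, q). A $$ (p div dim_row B, q div dim_col B) * B $$ (p mod dim_row B, q mod dim_col B))"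

definition pair_index :: "nat \<Rightarrow> nat \<Rightarrow> nat \<Rightarrow> nat" where
  "pair_index m i j = j * m + i"

(* Column stacking: the entry of index pair_index (dim_row A) i j is A $$ (i, j). *)
definition vectorize :: "'a mat \<Rightarrow> 'a vec" where
  "vectorize A = vec (dim_row A * dim_col A) (\<lambda>p. A $$ (p mod dim_row A, p div dim_row A))"

(* A tensor of order 3 over [m] is a function of three indices, of which only the values at
   indices below m matter. Column b m + c of its mode-1 matricization is X[:, b, c]. *)
type_synonym 'a tensor3 = "nat \<Rightarrow> nat \<Rightarrow> nat \<Rightarrow> 'a"

definition mode1 :: "nat \<Rightarrow> 'a tensor3 \<Rightarrow> 'a mat" where
  "mode1 m X = mat m (m * m) (\<lambda>(a, q). X a (q div m) (q mod m))"

lemma index_less: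
  fixes a b x y :: nat
  assumes "x < a" "y < b"
  shows "x * b + y < a * b"
proof -
  have "x * b + y < Suc x * b" using assms by simp
  also have "\<dots> \<le> a * b" using assms by (intro mult_le_mono1) simp
  finally show ?thesis .
qed

lemma kron_vec_unit:
  assumes "i < a" "j < b"
  shows "unit_vec a i \<otimes>\<^sub>v unit_vec b j = (unit_vec (a * b) (i * b + j) :: 'a :: semiring_1 vec)"
proof -
  have "i * b + j < a * b"
    using assms by (rule index_less)
  moreover have "p div b < a \<and> p mod b < b" if "p < a * b" for p
    using that assms by (simp add: less_mult_imp_div_less)
  moreover have "p = i * b + j" if "i = p div b" "j = p mod b" for p
    using that by simp
  ultimately show ?thesis
    using assms by (intro eq_vecI) (auto simp: kron_vec_def unit_vec_def)
qed

(* The equations that the theorem imposes on the permutation matrix P have exactly one solution. *)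
lemma ex1_shuffle_mat:
  "\<exists>!P :: real mat. P \<in> carrier_mat (m ^ 4 * n\<^sup>2) (m ^ 4 * n\<^sup>2) \<and>
     (\<forall>i<n. \<forall>j<m\<^sup>2. \<forall>k<n. \<forall>l<m\<^sup>2.
        P *\<^sub>v (unit_vec n i \<otimes>\<^sub>v unit_vec (m\<^sup>2) j \<otimes>\<^sub>v unit_vec n k \<otimes>\<^sub>v unit_vec (m\<^sup>2) l) =
          unit_vec n i \<otimes>\<^sub>v unit_vec n k \<otimes>\<^sub>v unit_vec (m\<^sup>2) j \<otimes>\<^sub>v unit_vec (m\<^sup>2) l)"
proof -
  define q where "q = m\<^sup>2"
  define N where "N = m ^ 4 * n\<^sup>2"
  have N1: "n * q * n * q = N" and N2: "n * n * q * q = N"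
    by (simp_all add: N_def q_def algebra_simps power2_eq_square power4_eq_xxxx)
  define src where "src i j k l = ((i * q + j) * n + k) * q + l" for i j k l
  define tgt where "tgt i j k l = ((i * n + k) * q + j) * q + l" for i j k l
  have bnd: "x * b + y < a * b" if "x < a" "y < b" for a b x y :: nat
    using that by (rule index_less)
  have unit_src: "unit_vec n i \<otimes>\<^sub>v unit_vec q j \<otimes>\<^sub>v unit_vec n k \<otimes>\<^sub>v unit_vec q l
      = (unit_vec N (src i j k l) :: real vec)"
    if "i < n" "j < q" "k < n" "l < q" for i j k l
    using that by (simp add: kron_vec_unit bnd src_def N1)
  have unit_tgt: "unit_vec n i \<otimes>\<^sub>v unit_vec n k \<otimes>\<^sub>v unit_vec q j \<otimes>\<^sub>v unit_vec q l
      = (unit_vec N (tgt i j k l) :: real vec)"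
    if "i < n" "j < q" "k < n" "l < q" for i j k l
    using that by (simp add: kron_vec_unit bnd tgt_def N2)
  have src_less: "src i j k l < N" if "i < n" "j < q" "k < n" "l < q" for i j k l
    using that unfolding src_def N1[symmetric] by (intro bnd)
  have src_split: "\<exists>i<n. \<exists>j<q. \<exists>k<n. \<exists>l<q. p = src i j k l" if "p < N" for p
  proof -
    have pos: "0 < q" "0 < n"
      using that N1 by (auto intro!: Nat.gr0I)
    have "p div q < n * q * n" "p div q div n < n * q" "p div q div n div q < n"
      using that N1 by (auto simp: less_mult_imp_div_less)
    moreover have "p = src (p div q div n div q) (p div q div n mod q) (p div q mod n) (p mod q)"
      by (simp add: src_def)
    ultimately show ?thesis using pos by (metis mod_less_divisor)
  qed
  have src_inj: "i = i' \<and> j = j' \<and> k = k' \<and> l = l'"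
    if "src i j k l = src i' j' k' l'" "j < q" "k < n" "l < q" "j' < q" "k' < n" "l' < q"
    for i j k l i' j' k' l'
  proof -
    have *: "x = x' \<and> y = y'" if "x * b + y = x' * b + y'" "y < b" "y' < b" for x y x' y' b :: nat
    proof -
      have "(x * b + y) div b = x" "(x' * b + y') div b = x'"
        using that(2,3) by simp_all
      then have "x = x'" using that(1) by metis
      then show ?thesis using that by simp
    qed
    show ?thesis using that unfolding src_def by (metis *)
  qed
  have col_eq: "M *\<^sub>v unit_vec N c = col M c" if "M \<in> carrier_mat N N" "c < N" for M :: "real mat" and c
    using that by (intro eq_vecI) (auto simp: scalar_prod_right_unit)
  define f where "f p = (THE t. \<exists>i<n. \<exists>j<q. \<exists>k<n. \<exists>l<q. p = src i j k l \<and> t = tgt i j k l)" for p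
  have f: "f (src i j k l) = tgt i j k l" if "i < n" "j < q" "k < n" "l < q" for i j k l
    unfolding f_def using that by (intro the_equality) (blast, metis src_inj)
  define P0 :: "real mat" where "P0 = mat N N (\<lambda>(r, c). if r = f c then 1 else 0)"
  have P0: "P0 \<in> carrier_mat N N" by (simp add: P0_def)
  have P0_col: "col P0 c = unit_vec N (f c)" if "c < N" for c
    using that by (intro eq_vecI) (auto simp: P0_def unit_vec_def)
  show ?thesis
    unfolding q_def[symmetric] N_def[symmetric]
  proof (rule ex1I[of _ P0])
    show "P0 \<in> carrier_mat N N \<and> (\<forall>i<n. \<forall>j<q. \<forall>k<n. \<forall>l<q.
        P0 *\<^sub>v (unit_vec n i \<otimes>\<^sub>v unit_vec q j \<otimes>\<^sub>v unit_vec n k \<otimes>\<^sub>v unit_vec q l) =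
          unit_vec n i \<otimes>\<^sub>v unit_vec n k \<otimes>\<^sub>v unit_vec q j \<otimes>\<^sub>v unit_vec q l)"
      by (simp add: P0 unit_src unit_tgt src_less col_eq P0_col f)
  next
    fix P :: "real mat"
    assume P: "P \<in> carrier_mat N N \<and> (\<forall>i<n. \<forall>j<q. \<forall>k<n. \<forall>l<q.
        P *\<^sub>v (unit_vec n i \<otimes>\<^sub>v unit_vec q j \<otimes>\<^sub>v unit_vec n k \<otimes>\<^sub>v unit_vec q l) =
          unit_vec n i \<otimes>\<^sub>v unit_vec n k \<otimes>\<^sub>v unit_vec q j \<otimes>\<^sub>v unit_vec q l)"
    have "col P c = col P0 c" if "c < N" for c
    proof -
      obtain i j k l where "i < n" "j < q" "k < n" "l < q" "c = src i j k l"
        using src_split[OF \<open>c < N\<close>] by blast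
      then show ?thesis
        using P \<open>c < N\<close> by (metis P0_col col_eq f unit_src unit_tgt)
    qed
    then show "P = P0"
      using P P0 by (intro mat_col_eqI) auto
  qed
qed


section \<open>Context-free grammars in Chomsky form\<close>

datatype 'a rule = Binary nat nat nat | Terminal nat 'a

datatype 'a tree = Leaf nat 'a | Node nat "'a tree" "'a tree"

fun root :: "'a tree \<Rightarrow> nat" where
  "root (Leaf i s) = i"
| "root (Node i l r) = i"

fun yield :: "'a tree \<Rightarrow> 'a list" where
  "yield (Leaf i s) = [s]"
| "yield (Node i l r) = yield l @ yield r"

fun derivation_tree :: "'a rule set \<Rightarrow> 'a tree \<Rightarrow> bool" where
  "derivation_tree R (Leaf i s) \<longleftrightarrow> Terminal i s \<in> R"
| "derivation_tree R (Node i l r) \<longleftrightarrow>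
     Binary i (root l) (root r) \<in> R \<and> derivation_tree R l \<and> derivation_tree R r"

definition chomsky_grammar :: "'a set \<Rightarrow> nat \<Rightarrow> nat \<Rightarrow> 'a rule set \<Rightarrow> bool" where
  "chomsky_grammar \<Sigma> n S R \<longleftrightarrow> S < n \<and> finite R \<and>
     (\<forall>i j k. Binary i j k \<in> R \<longrightarrow> i < n \<and> j < n \<and> k < n) \<and>
     (\<forall>i s. Terminal i s \<in> R \<longrightarrow> i < n \<and> s \<in> \<Sigma>)"

definition initial_vec :: "nat \<Rightarrow> nat \<Rightarrow> real vec" where
  "initial_vec n S = unit_vec n S"

definition rule_tensor :: "'a rule set \<Rightarrow> real tensor3" where
  "rule_tensor R i j k = (if Binary i j k \<in> R then 1 else 0)"

definition terminal_vec :: "nat \<Rightarrow> 'a rule set \<Rightarrow> 'a \<Rightarrow> real vec" where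
  "terminal_vec n R s = vec n (\<lambda>i. if Terminal i s \<in> R then 1 else 0)"

(* For a grammar in Chomsky form with finitely many rules the counted sets are finite, so
   card is the actual number of trees. *)
definition tree_count_vec :: "nat \<Rightarrow> 'a rule set \<Rightarrow> 'a list \<Rightarrow> real vec" where
  "tree_count_vec n R w =
     vec n (\<lambda>i. real (card {t. derivation_tree R t \<and> root t = i \<and> yield t = w}))"

definition grammar_fun :: "nat \<Rightarrow> nat \<Rightarrow> 'a rule set \<Rightarrow> 'a list \<Rightarrow> real" where
  "grammar_fun n S R w = initial_vec n S \<bullet> tree_count_vec n R w"

definition unambiguous :: "'a set \<Rightarrow> nat \<Rightarrow> nat \<Rightarrow> 'a rule set \<Rightarrow> bool" where
  "unambiguous \<Sigma> n S R \<longleftrightarrow> (\<forall>w \<in> lists \<Sigma>. grammar_fun n S R w \<le> 1)"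


section \<open>Hidden Markov models\<close>

definition hmm :: "'a set \<Rightarrow> nat \<Rightarrow> real vec \<Rightarrow> ('a \<Rightarrow> real mat) \<Rightarrow> bool" where
  "hmm \<Sigma> m \<pi> A \<longleftrightarrow>
     \<pi> \<in> carrier_vec m \<and> (\<forall>i<m. \<pi> $ i \<ge> 0) \<and> (\<Sum>i<m. \<pi> $ i) = 1 \<and>
     (\<forall>s\<in>\<Sigma>. A s \<in> carrier_mat m m \<and> (\<forall>i<m. \<forall>j<m. A s $$ (i, j) \<ge> 0)) \<and>
     (\<forall>i<m. (\<Sum>j<m. \<Sum>s\<in>\<Sigma>. A s $$ (i, j)) = 1)"

definition word_mat :: "nat \<Rightarrow> ('a \<Rightarrow> real mat) \<Rightarrow> 'a list \<Rightarrow> real mat" where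
  "word_mat m A w = foldr (\<lambda>s B. A s * B) w (1\<^sub>m m)"


section \<open>The combined vectors\<close>

definition beta_product ::
  "'a set \<Rightarrow> nat \<Rightarrow> 'a rule set \<Rightarrow> nat \<Rightarrow> ('a \<Rightarrow> real mat) \<Rightarrow> nat \<Rightarrow> real vec" where
  "beta_product \<Sigma> n R m A L = finsum_vec TYPE(real) (n * m\<^sup>2)
     (\<lambda>w. tree_count_vec n R w \<otimes>\<^sub>v vectorize (word_mat m A w)) {w \<in> lists \<Sigma>. length w = L}"

end

theory Submission
  imports Defs
begin

text \<open>
  A tree with yield \<open>w\<close>, where \<open>w\<close> has at least two letters, splits uniquely into a rule
  \<open>i \<rightarrow> j k\<close> and two subtrees whose yields \<open>u\<close> and \<open>v\<close> satisfy \<open>u v = w\<close>; hence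
  \<open>\<beta>(w)\<close> is the sum of \<open>M\<^sub>1 (\<beta>(u) \<otimes> \<beta>(v))\<close> over all such splits. The tensor \<open>T\<close> encodes
  matrix multiplication: \<open>T\<^sub>1 (vec A \<otimes> vec B) = vec (A B)\<close>. Since \<open>A\<^sub>u A\<^sub>v = A\<^sub>w\<close>, the
  mixed-product rule applied after the shuffle \<open>P\<close> sends
  \<open>(\<beta>(u) \<otimes> vec A\<^sub>u) \<otimes> (\<beta>(v) \<otimes> vec A\<^sub>v)\<close> to \<open>M\<^sub>1 (\<beta>(u) \<otimes> \<beta>(v)) \<otimes> vec A\<^sub>w\<close>. Summing
  over all words and all splits, and using bilinearity, gives the recursion.
\<close>

section \<open>Index arithmetic, Kronecker products and the shuffle permutation\<close>

lemma sum_mult_index: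
  fixes f :: "nat \<Rightarrow> 'a :: comm_monoid_add"
  shows "(\<Sum>p<a * b. f p) = (\<Sum>i<a. \<Sum>j<b. f (i * b + j))"
proof (induction a)
  case (Suc a)
  have "(\<Sum>p<c + d. f p) = (\<Sum>p<c. f p) + (\<Sum>j<d. f (c + j))" for c d
    by (induction d) (simp_all add: add.assoc)
  from this[of "a * b" b] show ?case
    by (simp add: Suc add.commute)
qed simp

lemma dim_kron_vec [simp]: "dim_vec (v \<otimes>\<^sub>v w) = dim_vec v * dim_vec w"
  by (simp add: kron_vec_def)

lemma dim_kron_mat [simp]:
  "dim_row (A \<otimes>\<^sub>m B) = dim_row A * dim_row B"
  "dim_col (A \<otimes>\<^sub>m B) = dim_col A * dim_col B"
  by (simp_all add: kron_mat_def)

lemma kron_vec_index: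
  assumes "i < dim_vec v" "j < dim_vec w"
  shows "(v \<otimes>\<^sub>v w) $ (i * dim_vec w + j) = v $ i * w $ j"
  using assms index_less[of i "dim_vec v" j "dim_vec w"] by (simp add: kron_vec_def)

lemma kron_mat_index:
  assumes "i < dim_row A" "j < dim_row B" "k < dim_col A" "l < dim_col B"
  shows "(A \<otimes>\<^sub>m B) $$ (i * dim_row B + j, k * dim_col B + l) = A $$ (i, k) * B $$ (j, l)"
  using assms index_less[of i "dim_row A" j "dim_row B"] index_less[of k "dim_col A" l "dim_col B"]
  by (simp add: kron_mat_def)

text \<open>Together with \<open>mult_add_inject\<close>, this gives existence and uniqueness of the
  pair of digits of a Kronecker index, so later proofs can work with pairs instead of
  \<open>div\<close> and \<open>mod\<close>.\<close>

lemma less_mult_split: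
  assumes "(p :: nat) < a * b"
  obtains i j where "i < a" "j < b" "p = i * b + j"
proof
  show "p div b < a" using assms by (rule less_mult_imp_div_less)
  show "p mod b < b" using assms by (cases "b = 0") auto
qed simp

lemma mult_add_inject:
  fixes x x' y y' b :: nat
  assumes "y < b" "y' < b"
  shows "x * b + y = x' * b + y' \<longleftrightarrow> x = x' \<and> y = y'"
proof
  assume "x * b + y = x' * b + y'"
  moreover have "(x * b + y) div b = x" "(x' * b + y') div b = x'" using assms by simp_all
  ultimately have "x = x'" by metis
  then show "x = x' \<and> y = y'" using \<open>x * b + y = x' * b + y'\<close> by simp
qed simp

lemma mult_mat_vec_index:
  assumes "i < dim_row A" "dim_col A = dim_vec v"
  shows "(A *\<^sub>v v) $ i = (\<Sum>j<dim_vec v. A $$ (i, j) * v $ j)"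
  using assms by (simp add: scalar_prod_def atLeast0LessThan)

text \<open>The mixed-product rule for a matrix acting on a vector. In row
  \<open>i * dim_row B + j\<close> the sum over columns is a double sum whose terms separate into a
  factor in \<open>k\<close> and a factor in \<open>l\<close>, hence a product of two sums.\<close>

lemma kron_mat_mult_kron_vec:
  fixes A B :: "'a :: comm_semiring_0 mat"
  assumes "dim_col A = dim_vec v" "dim_col B = dim_vec w"
  shows "(A \<otimes>\<^sub>m B) *\<^sub>v (v \<otimes>\<^sub>v w) = (A *\<^sub>v v) \<otimes>\<^sub>v (B *\<^sub>v w)"
proof (rule eq_vecI)
  fix p assume "p < dim_vec ((A *\<^sub>v v) \<otimes>\<^sub>v (B *\<^sub>v w))"
  then obtain i j where ij: "i < dim_row A" "j < dim_row B" and p: "p = i * dim_row B + j"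
    by (auto elim: less_mult_split)
  have p_less: "p < dim_row A * dim_row B" using ij by (simp add: p index_less)
  have "((A \<otimes>\<^sub>m B) *\<^sub>v (v \<otimes>\<^sub>v w)) $ p
      = (\<Sum>c<dim_vec v * dim_vec w. (A \<otimes>\<^sub>m B) $$ (p, c) * (v \<otimes>\<^sub>v w) $ c)"
    using assms p_less by (subst mult_mat_vec_index) simp_all
  also have "\<dots> = (\<Sum>k<dim_vec v. \<Sum>l<dim_vec w. (A $$ (i, k) * v $ k) * (B $$ (j, l) * w $ l))"
    unfolding sum_mult_index p using assms ij
    using kron_mat_index[of i A j B] kron_vec_index[of _ v _ w]
    by (intro sum.cong refl) (simp add: ac_simps)
  also have "\<dots> = (A *\<^sub>v v) $ i * (B *\<^sub>v w) $ j"
    using assms ij by (simp add: mult_mat_vec_index sum_product del: index_mult_mat_vec)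
  also have "\<dots> = ((A *\<^sub>v v) \<otimes>\<^sub>v (B *\<^sub>v w)) $ p"
    using ij kron_vec_index[of i "A *\<^sub>v v" j "B *\<^sub>v w"] by (simp add: p)
  finally show "((A \<otimes>\<^sub>m B) *\<^sub>v (v \<otimes>\<^sub>v w)) $ p = ((A *\<^sub>v v) \<otimes>\<^sub>v (B *\<^sub>v w)) $ p" .
qed simp

text \<open>The assumption on unit vectors prescribes every column of \<open>P\<close>: column
  \<open>?src i j k l\<close> has its single 1 in row \<open>?tgt i k j l\<close>. Both indices
  determine the four digits, so each row of \<open>P\<close> picks out exactly one entry of the
  vector, and that entry is the same product of four factors up to order.\<close>

lemma shuffle_mat_mult_kron:
  fixes P :: "'a :: comm_semiring_1 mat"
  assumes P_dim: "P \<in> carrier_mat (n * n * q * q) (n * n * q * q)"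
    and P: "\<And>i j k l. i < n \<Longrightarrow> j < q \<Longrightarrow> k < n \<Longrightarrow> l < q \<Longrightarrow>
      P *\<^sub>v (unit_vec n i \<otimes>\<^sub>v unit_vec q j \<otimes>\<^sub>v unit_vec n k \<otimes>\<^sub>v unit_vec q l) =
        unit_vec n i \<otimes>\<^sub>v unit_vec n k \<otimes>\<^sub>v unit_vec q j \<otimes>\<^sub>v unit_vec q l"
    and x: "dim_vec x = n" "dim_vec x' = n" and y: "dim_vec y = q" "dim_vec y' = q"
  shows "P *\<^sub>v ((x \<otimes>\<^sub>v y) \<otimes>\<^sub>v (x' \<otimes>\<^sub>v y')) = (x \<otimes>\<^sub>v x') \<otimes>\<^sub>v (y \<otimes>\<^sub>v y')"
proof (rule eq_vecI)
  let ?N = "n * n * q * q"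
  \<comment> \<open>The left-nested products of unit vectors yield indices in Horner form, such as
    \<open>((i * q + j) * n + k) * q + l\<close>. Here the digits are grouped in pairs instead,
    matching the bracketing in the conclusion; the two forms are the same number.\<close>
  let ?src = "\<lambda>i j k l. (i * q + j) * (n * q) + (k * q + l)"
  let ?tgt = "\<lambda>i k j l. (i * n + k) * (q * q) + (j * q + l)"
  have N: "(n * q) * (n * q) = ?N" "n * q * n * q = ?N" "(n * n) * (q * q) = ?N"
    by (simp_all add: algebra_simps)
  have src_less: "?src i j k l < ?N" if "i < n" "j < q" "k < n" "l < q" for i j k l
    unfolding N(1)[symmetric] using that by (intro index_less)
  have entry: "P $$ (r, ?src i j k l) = (if r = ?tgt i k j l then 1 else 0)"
    if "i < n" "j < q" "k < n" "l < q" "r < ?N" for i j k l r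
  proof -
    have src: "unit_vec n i \<otimes>\<^sub>v unit_vec q j \<otimes>\<^sub>v unit_vec n k \<otimes>\<^sub>v unit_vec q l
        = (unit_vec ?N (?src i j k l) :: 'a vec)"
      using that by (simp add: kron_vec_unit index_less N(2)) (simp add: algebra_simps)
    have tgt: "unit_vec n i \<otimes>\<^sub>v unit_vec n k \<otimes>\<^sub>v unit_vec q j \<otimes>\<^sub>v unit_vec q l
        = (unit_vec ?N (?tgt i k j l) :: 'a vec)"
      using that by (simp add: kron_vec_unit index_less) (simp add: algebra_simps)
    have "P $$ (r, ?src i j k l) = (P *\<^sub>v unit_vec ?N (?src i j k l)) $ r"
      using that src_less[OF that(1-4)] P_dim by (auto simp: scalar_prod_right_unit)
    also have "\<dots> = (unit_vec ?N (?tgt i k j l) :: 'a vec) $ r"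
      using P[OF that(1-4)] by (simp only: src tgt)
    finally show ?thesis using that by (simp add: unit_vec_def)
  qed
  fix p assume "p < dim_vec ((x \<otimes>\<^sub>v x') \<otimes>\<^sub>v (y \<otimes>\<^sub>v y'))"
  then have p_less: "p < ?N" and "p < (n * n) * (q * q)" by (simp_all add: x y N)
  then obtain i k j l where ijkl: "i < n" "j < q" "k < n" "l < q" and p: "p = ?tgt i k j l"
    by (metis less_mult_split)
  let ?v = "(x \<otimes>\<^sub>v y) \<otimes>\<^sub>v (x' \<otimes>\<^sub>v y')"
  have "(P *\<^sub>v ?v) $ p = (\<Sum>c<?N. P $$ (p, c) * ?v $ c)"
    using p_less P_dim by (subst mult_mat_vec_index) (auto simp: x y N)
  also have "\<dots> = (\<Sum>c<?N. if c = ?src i j k l then ?v $ c else 0)"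
  proof (rule sum.cong)
    fix c assume "c \<in> {..<?N}"
    then have "c < (n * q) * (n * q)" by (simp add: N)
    then obtain i' j' k' l' where "i' < n" "j' < q" "k' < n" "l' < q" and c: "c = ?src i' j' k' l'"
      by (metis less_mult_split)
    then show "P $$ (p, c) * ?v $ c = (if c = ?src i j k l then ?v $ c else 0)"
      using ijkl entry[of i' j' k' l' p] p_less
      by (auto simp: p c mult_add_inject index_less)
  qed simp
  also have "\<dots> = ?v $ ?src i j k l"
    using src_less[OF ijkl] by simp
  also have "\<dots> = x $ i * y $ j * (x' $ k * y' $ l)"
    using ijkl x y kron_vec_index[of "i * q + j" "x \<otimes>\<^sub>v y" "k * q + l" "x' \<otimes>\<^sub>v y'"]
      kron_vec_index[of i x j y] kron_vec_index[of k x' l y'] by (simp add: index_less)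
  also have "\<dots> = ((x \<otimes>\<^sub>v x') \<otimes>\<^sub>v (y \<otimes>\<^sub>v y')) $ p"
    using ijkl x y kron_vec_index[of "i * n + k" "x \<otimes>\<^sub>v x'" "j * q + l" "y \<otimes>\<^sub>v y'"]
      kron_vec_index[of i x k x'] kron_vec_index[of j y l y'] index_less[of i n k n] index_less[of j q l q]
    by (simp add: p ac_simps)
  finally show "(P *\<^sub>v ?v) $ p = ((x \<otimes>\<^sub>v x') \<otimes>\<^sub>v (y \<otimes>\<^sub>v y')) $ p" .
qed (use P_dim in \<open>simp add: x y\<close>)

section \<open>Mode-1 matricization and the matrix multiplication tensor\<close>

lemma mode1_mult_kron_vec_index:
  assumes "a < m" "dim_vec v = m" "dim_vec w = m"
  shows "(mode1 m X *\<^sub>v (v \<otimes>\<^sub>v w)) $ a = (\<Sum>b<m. \<Sum>c<m. X a b c * (v $ b * w $ c))"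
proof -
  have "(mode1 m X *\<^sub>v (v \<otimes>\<^sub>v w)) $ a = (\<Sum>q<m * m. mode1 m X $$ (a, q) * (v \<otimes>\<^sub>v w) $ q)"
    using assms by (subst mult_mat_vec_index) (simp_all add: mode1_def)
  also have "\<dots> = (\<Sum>b<m. \<Sum>c<m. X a b c * (v $ b * w $ c))"
    unfolding sum_mult_index using assms kron_vec_index[of _ v _ w]
    by (intro sum.cong refl) (simp add: mode1_def index_less)
  finally show ?thesis .
qed

lemma vectorize_index:
  assumes "A \<in> carrier_mat m m" "i < m" "j < m"
  shows "vectorize A $ pair_index m i j = A $$ (i, j)"
  using assms index_less[of j m i m] by (simp add: vectorize_def pair_index_def)

text \<open>\<open>T\<close> is the structure tensor of matrix multiplication: its conditions fix
  the row of \<open>A\<close> and the column of \<open>B\<close> to those of the output entry and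
  identify the column of \<open>A\<close> with the row of \<open>B\<close>, which leaves the sum
  defining \<open>A * B\<close>.\<close>

lemma vectorize_mult:
  fixes A B :: "'a :: comm_semiring_1 mat"
  assumes A: "A \<in> carrier_mat m m" and B: "B \<in> carrier_mat m m"
    and T: "\<And>i1 j1 i2 j2 i3 j3.
      i1 < m \<Longrightarrow> j1 < m \<Longrightarrow> i2 < m \<Longrightarrow> j2 < m \<Longrightarrow> i3 < m \<Longrightarrow> j3 < m \<Longrightarrow>
      T (pair_index m i1 j1) (pair_index m i2 j2) (pair_index m i3 j3) =
        (if i1 = i2 \<and> j1 = j3 \<and> j2 = i3 then 1 else 0)"
  shows "mode1 (m * m) T *\<^sub>v (vectorize A \<otimes>\<^sub>v vectorize B) = vectorize (A * B)"
proof (rule eq_vecI)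
  have dim: "dim_vec (vectorize A) = m * m" "dim_vec (vectorize B) = m * m"
    using A B by (auto simp: vectorize_def)
  fix p assume "p < dim_vec (vectorize (A * B))"
  then have "p < m * m" using A B by (simp add: vectorize_def)
  then obtain i j where ij: "i < m" "j < m" and p: "p = pair_index m i j"
    by (metis less_mult_split pair_index_def)
  have "(mode1 (m * m) T *\<^sub>v (vectorize A \<otimes>\<^sub>v vectorize B)) $ p
      = (\<Sum>b<m * m. \<Sum>c<m * m. T p b c * (vectorize A $ b * vectorize B $ c))"
    using dim \<open>p < m * m\<close> by (simp only: mode1_mult_kron_vec_index)
  \<comment> \<open>Column stacking makes the column the leading digit, so each \<open>j\<close> is
    summed outside its \<open>i\<close>. The conditionals are nested so that the sums over
    \<open>i3\<close>, \<open>j3\<close> and \<open>i2\<close> collapse one after another from the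
    inside; \<open>j2\<close> remains as the summation index of the matrix product.\<close>
  also have "\<dots> = (\<Sum>j2<m. \<Sum>i2<m. \<Sum>j3<m. \<Sum>i3<m.
      if i3 = j2 then if j3 = j then if i2 = i then A $$ (i2, j2) * B $$ (i3, j3) else 0 else 0 else 0)"
    unfolding sum_mult_index pair_index_def[symmetric] p using ij
    by (intro sum.cong refl) (auto simp: T vectorize_index[OF A] vectorize_index[OF B])
  also have "\<dots> = (\<Sum>k<m. A $$ (i, k) * B $$ (k, j))"
    using ij by simp
  also have "\<dots> = vectorize (A * B) $ p"
    using A B ij by (simp add: p vectorize_index[of "A * B" m] scalar_prod_def atLeast0LessThan)
  finally show "(mode1 (m * m) T *\<^sub>v (vectorize A \<otimes>\<^sub>v vectorize B)) $ p = vectorize (A * B) $ p" .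
qed (use A B in \<open>simp add: vectorize_def mode1_def\<close>)

section \<open>Matrices of words\<close>

lemma word_mat_carrier:
  assumes A: "\<And>s. s \<in> \<Sigma> \<Longrightarrow> A s \<in> carrier_mat m m" and "w \<in> lists \<Sigma>"
  shows "word_mat m A w \<in> carrier_mat m m"
  using assms(2)
proof induction
  case (Cons s w)
  then show ?case using mult_carrier_mat[OF A] by (simp add: word_mat_def)
qed (simp add: word_mat_def)

lemma word_mat_append:
  assumes A: "\<And>s. s \<in> \<Sigma> \<Longrightarrow> A s \<in> carrier_mat m m" and u: "u \<in> lists \<Sigma>" and v: "v \<in> lists \<Sigma>"
  shows "word_mat m A (u @ v) = word_mat m A u * word_mat m A v"
  using u
proof induction
  case Nil
  then show ?case using left_mult_one_mat[OF word_mat_carrier[OF A v]] by (simp add: word_mat_def)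
next
  case (Cons s u)
  have "word_mat m A u \<in> carrier_mat m m"
    using Cons.hyps by (intro word_mat_carrier[OF A])
  from assoc_mult_mat[OF A[OF Cons.hyps(1)] this word_mat_carrier[OF A v]] Cons.IH show ?case
    by (simp add: word_mat_def)
qed

section \<open>Derivation trees and the counting recursion\<close>

lemma yield_not_Nil [simp]: "yield t \<noteq> []"
  by (induction t) auto

definition trees :: "'a rule set \<Rightarrow> nat \<Rightarrow> 'a list \<Rightarrow> 'a tree set" where
  "trees R i w = {t. derivation_tree R t \<and> root t = i \<and> yield t = w}"

lemma trees_letter: "trees R i [s] = (if Terminal i s \<in> R then {Leaf i s} else {})"
proof -
  have "t = Leaf i s \<and> Terminal i s \<in> R" if "derivation_tree R t" "root t = i" "yield t = [s]" for t
    using that by (cases t) (auto simp: append_eq_Cons_conv)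
  then show ?thesis by (auto simp: trees_def)
qed

text \<open>The trees whose left subtree yields the first \<open>p\<close> letters and whose
  subtrees have roots \<open>j\<close> and \<open>k\<close>. The set is empty when the rule is
  absent, so unions and sums can run over all \<open>j\<close> and \<open>k\<close> instead of over
  the rules.\<close>

definition split_trees :: "'a rule set \<Rightarrow> nat \<Rightarrow> 'a list \<Rightarrow> nat \<Rightarrow> nat \<Rightarrow> nat \<Rightarrow> 'a tree set" where
  "split_trees R i w p j k = (\<lambda>(l, r). Node i l r) `
     (if Binary i j k \<in> R then trees R j (take p w) \<times> trees R k (drop p w) else {})"

text \<open>A leaf yields only one letter, so the tree is a \<open>Node\<close>. Yields are never
  empty, hence the cut lies strictly inside \<open>w\<close>; the roots of the subtrees are bounded
  because they occur in a binary rule.\<close>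

lemma trees_split:
  assumes R: "\<And>i j k. Binary i j k \<in> R \<Longrightarrow> j < n \<and> k < n" and w: "length w > 1"
  shows "trees R i w = (\<Union>p\<in>{1..length w - 1}. \<Union>j<n. \<Union>k<n. split_trees R i w p j k)"
proof (intro equalityI subsetI)
  fix t assume t: "t \<in> trees R i w"
  then obtain l r where lr: "t = Node i l r" using w by (cases t) (auto simp: trees_def)
  with t have w_eq: "w = yield l @ yield r" by (simp add: trees_def)
  have "t \<in> split_trees R i w (length (yield l)) (root l) (root r)"
    using t lr w_eq by (auto simp: split_trees_def trees_def)
  moreover have "length (yield l) \<in> {1..length w - 1}"
    using yield_not_Nil[of l] yield_not_Nil[of r] unfolding w_eq length_greater_0_conv[symmetric]
    by (simp add: Suc_le_eq del: yield_not_Nil length_greater_0_conv)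
  moreover have "root l < n" "root r < n" using t lr R by (auto simp: trees_def)
  ultimately show "t \<in> (\<Union>p\<in>{1..length w - 1}. \<Union>j<n. \<Union>k<n. split_trees R i w p j k)" by blast
qed (auto simp: split_trees_def trees_def split: if_splits)

text \<open>Needed because \<open>card\<close> of an infinite set is 0. Induction on the length of
  \<open>w\<close> works since both parts of a cut strictly inside \<open>w\<close> are shorter than
  \<open>w\<close>.\<close>

lemma finite_trees:
  assumes R: "\<And>i j k. Binary i j k \<in> R \<Longrightarrow> j < n \<and> k < n"
  shows "finite (trees R i w)"
proof (induction w arbitrary: i rule: length_induct)
  case (1 w)
  show ?case
  proof (cases "length w > 1")
    case True
    have "finite (trees R j (take p w))" "finite (trees R j (drop p w))"
      if "p \<in> {1..length w - 1}" for p j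
      using 1 that True by auto
    then have "finite (split_trees R i w p j k)" if "p \<in> {1..length w - 1}" for p j k
      using that by (simp add: split_trees_def)
    then show ?thesis
      by (subst trees_split[OF R True]) auto
  next
    case False
    then consider "w = []" | s where "w = [s]"
      by (cases w) auto
    then show ?thesis
    proof cases
      case 1
      then show ?thesis by (simp add: trees_def)
    qed (simp add: trees_letter)
  qed
qed

lemma card_trees_split:
  assumes R: "\<And>i j k. Binary i j k \<in> R \<Longrightarrow> j < n \<and> k < n" and w: "length w > 1"
  shows "card (trees R i w) = (\<Sum>p = 1..length w - 1. \<Sum>j<n. \<Sum>k<n.
    if Binary i j k \<in> R then card (trees R j (take p w)) * card (trees R k (drop p w)) else 0)"
proof -
  have fin: "finite (split_trees R i w p j k)" for p j k
    by (simp add: split_trees_def finite_trees[OF R])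
  \<comment> \<open>A tree determines its cut and its two root labels, so the pieces are disjoint.
    The bounds on \<open>p\<close> and \<open>p'\<close> matter: beyond \<open>length w\<close>,
    equal prefixes would not force equal cut positions.\<close>
  have key: "p = p' \<and> j = j' \<and> k = k'"
    if t: "t \<in> split_trees R i w p j k" "t \<in> split_trees R i w p' j' k'"
      and le: "p \<le> length w" "p' \<le> length w" for t p j k p' j' k'
  proof -
    have "take p w = take p' w" "j = j'" "k = k'"
      using t by (auto simp: split_trees_def trees_def split: if_splits)
    then show ?thesis using le by (metis length_take min.absorb2)
  qed
  have card: "card (split_trees R i w p j k)
      = (if Binary i j k \<in> R then card (trees R j (take p w)) * card (trees R k (drop p w)) else 0)"
    for p j k
    unfolding split_trees_def
    by (subst card_image) (auto simp: inj_on_def card_cartesian_product)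
  let ?I = "{1..length w - 1} \<times> {..<n} \<times> {..<n}"
  let ?A = "\<lambda>(p, j, k). split_trees R i w p j k"
  have "trees R i w = (\<Union>s\<in>?I. ?A s)"
    by (subst trees_split[OF R w]) auto
  moreover have "card (\<Union>s\<in>?I. ?A s) = (\<Sum>s\<in>?I. card (?A s))"
  proof (intro card_UN_disjoint ballI impI)
    fix s s' assume in_I: "s \<in> ?I" "s' \<in> ?I" and ne: "s \<noteq> s'"
    obtain p j k p' j' k' where s: "s = (p, j, k)" "s' = (p', j', k')"
      by (metis prod_cases3)
    with in_I have "p \<le> length w" "p' \<le> length w" by auto
    then show "?A s \<inter> ?A s' = {}"
      using key[of _ p j k p' j' k'] ne by (simp only: s prod.case prod.inject) blast
  qed (simp_all add: fin split: prod.split)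
  ultimately show ?thesis
    by (simp add: card sum.cartesian_product split_def)
qed

lemma tree_count_vec_index:
  "i < n \<Longrightarrow> tree_count_vec n R w $ i = real (card (trees R i w))"
  by (simp add: tree_count_vec_def trees_def)

lemma dim_tree_count_vec [simp]: "dim_vec (tree_count_vec n R w) = n"
  by (simp add: tree_count_vec_def)

lemma tree_count_vec_letter: "tree_count_vec n R [s] = terminal_vec n R s"
  by (intro eq_vecI) (auto simp: tree_count_vec_index terminal_vec_def trees_letter)

text \<open>The recursion for the vectors of tree counts, derived from the definition by counting
  trees. The factorizations of \<open>w\<close> into two nonempty words are indexed by the cut
  position \<open>p\<close>.\<close>

lemma tree_count_vec_split:
  assumes R: "\<And>i j k. Binary i j k \<in> R \<Longrightarrow> j < n \<and> k < n" and "length w > 1" "i < n"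
  shows "tree_count_vec n R w $ i = (\<Sum>p = 1..length w - 1.
    (mode1 n (rule_tensor R) *\<^sub>v
      (tree_count_vec n R (take p w) \<otimes>\<^sub>v tree_count_vec n R (drop p w))) $ i)"
  using assms(2,3)
  by (simp add: tree_count_vec_index card_trees_split[OF R] mode1_mult_kron_vec_index rule_tensor_def
      del: index_mult_mat_vec) (auto intro!: sum.cong)

section \<open>Sums over words and linearity of finite vector sums\<close>

definition words :: "'a set \<Rightarrow> nat \<Rightarrow> 'a list set" where
  "words \<Sigma> L = {w \<in> lists \<Sigma>. length w = L}"

lemma finite_words: "finite \<Sigma> \<Longrightarrow> finite (words \<Sigma> L)"
  using finite_lists_length_eq[of \<Sigma> L] by (simp add: words_def lists_eq_set)

text \<open>Cutting at the fixed position \<open>p\<close> is a bijection from words of length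
  \<open>L\<close> to pairs of words of lengths \<open>p\<close> and \<open>L - p\<close>, with
  concatenation as inverse.\<close>

lemma sum_words_split:
  assumes "p \<le> L"
  shows "(\<Sum>w\<in>words \<Sigma> L. g (take p w) (drop p w)) = (\<Sum>u\<in>words \<Sigma> p. \<Sum>v\<in>words \<Sigma> (L - p). g u v)"
proof -
  have "(\<Sum>w\<in>words \<Sigma> L. g (take p w) (drop p w))
      = (\<Sum>(u, v)\<in>words \<Sigma> p \<times> words \<Sigma> (L - p). g u v)"
    using assms
    by (intro sum.reindex_bij_witness[of _ "\<lambda>(u, v). u @ v" "\<lambda>w. (take p w, drop p w)"])
      (auto simp: words_def dest: in_set_takeD in_set_dropD)
  then show ?thesis by (simp add: sum.cartesian_product)
qed

text \<open>Linearity of a matrix in one entry. The vector \<open>v\<close> is described only by its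
  entries, so it can be a nested \<open>finsum_vec\<close> while the right-hand side sums over a
  single flat index set.\<close>

lemma index_mult_mat_vec_sum:
  fixes A :: "'a :: comm_semiring_0 mat"
  assumes "p < dim_row A" "dim_vec v = dim_col A" "\<And>t. t \<in> I \<Longrightarrow> dim_vec (h t) = dim_col A"
    and "\<And>c. c < dim_col A \<Longrightarrow> v $ c = (\<Sum>t\<in>I. h t $ c)"
  shows "(A *\<^sub>v v) $ p = (\<Sum>t\<in>I. (A *\<^sub>v h t) $ p)"
proof -
  have "(A *\<^sub>v v) $ p = (\<Sum>c<dim_col A. \<Sum>t\<in>I. A $$ (p, c) * h t $ c)"
    using assms by (subst mult_mat_vec_index) (simp_all add: sum_distrib_left)
  also have "\<dots> = (\<Sum>t\<in>I. \<Sum>c<dim_col A. A $$ (p, c) * h t $ c)"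
    by (rule sum.swap)
  also have "\<dots> = (\<Sum>t\<in>I. (A *\<^sub>v h t) $ p)"
    using assms by (intro sum.cong refl, subst mult_mat_vec_index) simp_all
  finally show ?thesis .
qed

lemma dim_finsum_vec:
  assumes "f \<in> F \<rightarrow> carrier_vec n"
  shows "dim_vec (finsum_vec TYPE('a :: comm_monoid_add) n f F) = n"
  using finsum_vec_closed[OF assms] by simp

text \<open>Bilinearity of the Kronecker product in one entry: at \<open>i * n + j\<close> the entry
  is a product of two sums, which expands into a double sum.\<close>

lemma kron_vec_finsum_index:
  fixes f :: "'b \<Rightarrow> 'a :: comm_semiring_0 vec" and g :: "'c \<Rightarrow> 'a vec"
  assumes "finite F" "finite G" and f: "f \<in> F \<rightarrow> carrier_vec m" and g: "g \<in> G \<rightarrow> carrier_vec n"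
    and c: "c < m * n"
  shows "(finsum_vec TYPE('a) m f F \<otimes>\<^sub>v finsum_vec TYPE('a) n g G) $ c
    = (\<Sum>u\<in>F. \<Sum>v\<in>G. (f u \<otimes>\<^sub>v g v) $ c)"
proof -
  obtain i j where ij: "i < m" "j < n" and c_eq: "c = i * n + j"
    using less_mult_split[OF c] by blast
  have "dim_vec (f u) = m" if "u \<in> F" for u using that f by (metis PiE carrier_vecD)
  moreover have "dim_vec (g v) = n" if "v \<in> G" for v using that g by (metis PiE carrier_vecD)
  ultimately have "(f u \<otimes>\<^sub>v g v) $ c = f u $ i * g v $ j" if "u \<in> F" "v \<in> G" for u v
    using that ij kron_vec_index[of i "f u" j "g v"] by (simp add: c_eq)
  then show ?thesis
    using assms ij
      kron_vec_index[of i "finsum_vec TYPE('a) m f F" j "finsum_vec TYPE('a) n g G"]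
    by (simp add: c_eq dim_finsum_vec index_finsum_vec sum_product)
qed

section \<open>The recursion for the combined vectors\<close>

theorem theorem3:
  fixes \<Sigma> :: "'a set"
    and n S :: nat and R :: "'a rule set"
    and n' :: nat and \<pi>' :: "real vec" and A' :: "'a \<Rightarrow> real mat"
    and T :: "real tensor3" and P :: "real mat"
  assumes alphabet: "finite \<Sigma>"
    and grammar: "chomsky_grammar \<Sigma> n S R"
    and unambiguous: "unambiguous \<Sigma> n S R"
    and hmm: "hmm \<Sigma> n' \<pi>' A'"
    and T: "\<And>i1 j1 i2 j2 i3 j3.
      i1 < n' \<Longrightarrow> j1 < n' \<Longrightarrow> i2 < n' \<Longrightarrow> j2 < n' \<Longrightarrow> i3 < n' \<Longrightarrow> j3 < n' \<Longrightarrow>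
      T (pair_index n' i1 j1) (pair_index n' i2 j2) (pair_index n' i3 j3) =
        (if i1 = i2 \<and> j1 = j3 \<and> j2 = i3 then 1 else 0)"
    and P_dim: "P \<in> carrier_mat (n' ^ 4 * n\<^sup>2) (n' ^ 4 * n\<^sup>2)"
    and P: "\<And>i j k l. i < n \<Longrightarrow> j < n'\<^sup>2 \<Longrightarrow> k < n \<Longrightarrow> l < n'\<^sup>2 \<Longrightarrow>
      P *\<^sub>v (unit_vec n i \<otimes>\<^sub>v unit_vec (n'\<^sup>2) j \<otimes>\<^sub>v unit_vec n k \<otimes>\<^sub>v unit_vec (n'\<^sup>2) l) =
        unit_vec n i \<otimes>\<^sub>v unit_vec n k \<otimes>\<^sub>v unit_vec (n'\<^sup>2) j \<otimes>\<^sub>v unit_vec (n'\<^sup>2) l"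
  shows "beta_product \<Sigma> n R n' A' 1 =
           finsum_vec TYPE(real) (n * n'\<^sup>2)
             (\<lambda>s. terminal_vec n R s \<otimes>\<^sub>v vectorize (A' s)) \<Sigma>
       \<and> (\<forall>L>1. beta_product \<Sigma> n R n' A' L =
           (mode1 n (rule_tensor R) \<otimes>\<^sub>m mode1 (n'\<^sup>2) T) * P *\<^sub>v
             finsum_vec TYPE(real) (n\<^sup>2 * n' ^ 4)
               (\<lambda>i. beta_product \<Sigma> n R n' A' i \<otimes>\<^sub>v beta_product \<Sigma> n R n' A' (L - i)) {1..L - 1})"
proof -
  define q where "q = n'\<^sup>2"
  define x where "x = tree_count_vec n R"
  define y where "y w = vectorize (word_mat n' A' w)" for w
  define z where "z w = x w \<otimes>\<^sub>v y w" for w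
  define M where "M = mode1 n (rule_tensor R)"
  define K where "K = (M \<otimes>\<^sub>m mode1 q T) * P"
  have q: "q = n' * n'" by (simp add: q_def power2_eq_square)
  have R: "j < n \<and> k < n" if "Binary i j k \<in> R" for i j k
    using that grammar by (auto simp: chomsky_grammar_def)
  have A': "A' s \<in> carrier_mat n' n'" if "s \<in> \<Sigma>" for s
    using that hmm by (auto simp: hmm_def)
  have W: "word_mat n' A' w \<in> carrier_mat n' n'" if "w \<in> lists \<Sigma>" for w
    using word_mat_carrier[OF A' that] .
  have dim_x: "dim_vec (x w) = n" for w by (simp add: x_def)
  have dim_y: "dim_vec (y w) = q" if "w \<in> lists \<Sigma>" for w
    using W[OF that] by (auto simp: y_def vectorize_def q)
  have z_carrier: "z \<in> words \<Sigma> L \<rightarrow> carrier_vec (n * q)" for L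
    by (auto simp: z_def words_def dim_x intro!: carrier_vecI dim_y)
  have dim_z: "dim_vec (z w) = n * q" if "w \<in> words \<Sigma> L" for w L
    using that z_carrier by (metis PiE carrier_vecD)
  have beta: "beta_product \<Sigma> n R n' A' L = finsum_vec TYPE(real) (n * q) z (words \<Sigma> L)" for L
    by (simp add: beta_product_def words_def z_def[abs_def] x_def y_def q_def)
  have beta_dim: "dim_vec (beta_product \<Sigma> n R n' A' L) = n * q" for L
    unfolding beta by (rule dim_finsum_vec[OF z_carrier])
  have N: "n' ^ 4 * n\<^sup>2 = n * n * q * q" "n\<^sup>2 * n' ^ 4 = n * n * q * q"
    by (simp_all add: q power2_eq_square power4_eq_xxxx)
  have P_carrier: "P \<in> carrier_mat (n * n * q * q) (n * n * q * q)"
    using P_dim by (simp only: N)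
  have dim_M: "dim_row M = n" by (simp add: M_def mode1_def)
  have MT_carrier: "M \<otimes>\<^sub>m mode1 q T \<in> carrier_mat (n * q) (n * n * q * q)"
    by (auto simp: M_def mode1_def intro!: carrier_matI)
  have K_dim: "dim_row K = n * q" "dim_col K = n * n * q * q"
    using MT_carrier P_carrier by (auto simp: K_def)
  \<comment> \<open>The second factor on the right depends only on the concatenation
    \<open>u @ v\<close>, so it is common to all cuts of one word.\<close>
  have K_kron: "K *\<^sub>v (z u \<otimes>\<^sub>v z v) = (M *\<^sub>v (x u \<otimes>\<^sub>v x v)) \<otimes>\<^sub>v y (u @ v)"
    if "u \<in> lists \<Sigma>" "v \<in> lists \<Sigma>" for u v
  proof -
    have "z u \<otimes>\<^sub>v z v \<in> carrier_vec (n * n * q * q)"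
      using that by (intro carrier_vecI) (simp add: z_def dim_x dim_y)
    then have "K *\<^sub>v (z u \<otimes>\<^sub>v z v) = (M \<otimes>\<^sub>m mode1 q T) *\<^sub>v (P *\<^sub>v (z u \<otimes>\<^sub>v z v))"
      unfolding K_def using MT_carrier P_carrier by simp
    also have "P *\<^sub>v (z u \<otimes>\<^sub>v z v) = (x u \<otimes>\<^sub>v x v) \<otimes>\<^sub>v (y u \<otimes>\<^sub>v y v)"
      unfolding z_def using that P_carrier P
      by (intro shuffle_mat_mult_kron) (auto simp: q_def[symmetric] dim_x dim_y)
    also have "(M \<otimes>\<^sub>m mode1 q T) *\<^sub>v \<dots> = (M *\<^sub>v (x u \<otimes>\<^sub>v x v)) \<otimes>\<^sub>v (mode1 q T *\<^sub>v (y u \<otimes>\<^sub>v y v))"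
      using that by (intro kron_mat_mult_kron_vec) (simp_all add: M_def mode1_def dim_x dim_y)
    also have "mode1 q T *\<^sub>v (y u \<otimes>\<^sub>v y v) = y (u @ v)"
      unfolding y_def q using that T
      by (subst vectorize_mult[OF W W]) (simp_all add: word_mat_append[of \<Sigma>, OF A'])
    finally show ?thesis .
  qed
  have letter: "z [s] = terminal_vec n R s \<otimes>\<^sub>v vectorize (A' s)" if "s \<in> \<Sigma>" for s
    using A'[OF that] by (simp add: z_def x_def y_def tree_count_vec_letter word_mat_def)
  have letter_carrier: "(\<lambda>s. terminal_vec n R s \<otimes>\<^sub>v vectorize (A' s)) \<in> \<Sigma> \<rightarrow> carrier_vec (n * q)"
    using z_carrier[of 1] by (auto simp: letter[symmetric] words_def Pi_def)
  have "beta_product \<Sigma> n R n' A' 1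
      = finsum_vec TYPE(real) (n * q) (\<lambda>s. terminal_vec n R s \<otimes>\<^sub>v vectorize (A' s)) \<Sigma>"
  proof (rule eq_vecI)
    fix p assume "p < dim_vec (finsum_vec TYPE(real) (n * q)
        (\<lambda>s. terminal_vec n R s \<otimes>\<^sub>v vectorize (A' s)) \<Sigma>)"
    then have p: "p < n * q" using dim_finsum_vec[OF letter_carrier] by simp
    \<comment> \<open>Words of length 1 correspond to letters through \<open>[s]\<close> and
      \<open>hd\<close>.\<close>
    have "(\<Sum>w\<in>words \<Sigma> 1. z w $ p) = (\<Sum>s\<in>\<Sigma>. (terminal_vec n R s \<otimes>\<^sub>v vectorize (A' s)) $ p)"
      by (intro sum.reindex_bij_witness[of _ "\<lambda>s. [s]" hd])
        (auto simp: words_def length_Suc_conv letter)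
    then show "beta_product \<Sigma> n R n' A' 1 $ p
        = finsum_vec TYPE(real) (n * q) (\<lambda>s. terminal_vec n R s \<otimes>\<^sub>v vectorize (A' s)) \<Sigma> $ p"
      using p alphabet
      by (simp add: beta index_finsum_vec finite_words z_carrier letter_carrier)
  qed (simp add: beta_dim dim_finsum_vec[OF letter_carrier])
  moreover have "beta_product \<Sigma> n R n' A' L = K *\<^sub>v finsum_vec TYPE(real) (n * n * q * q)
      (\<lambda>i. beta_product \<Sigma> n R n' A' i \<otimes>\<^sub>v beta_product \<Sigma> n R n' A' (L - i)) {1..L - 1}"
    (is "_ = K *\<^sub>v finsum_vec _ _ ?B _") if L: "L > 1" for L
  proof (rule eq_vecI)
    let ?V = "finsum_vec TYPE(real) (n * n * q * q) ?B {1..L - 1}"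
    \<comment> \<open>Triples of a cut position and the two words on its sides. Flattening the three
      sums into one lets linearity of \<open>K\<close> be applied once.\<close>
    let ?I = "SIGMA i:{1..L - 1}. words \<Sigma> i \<times> words \<Sigma> (L - i)"
    let ?h = "\<lambda>(i :: nat, u, v). z u \<otimes>\<^sub>v z v"
    have B_carrier: "?B \<in> {1..L - 1} \<rightarrow> carrier_vec (n * n * q * q)"
      by (auto intro!: carrier_vecI simp: beta_dim)
    have V: "?V $ c = (\<Sum>t\<in>?I. ?h t $ c)" if "c < n * n * q * q" for c
    proof -
      have c: "c < (n * q) * (n * q)" using that by (simp add: ac_simps)
      have "?V $ c = (\<Sum>i\<in>{1..L - 1}. ?B i $ c)"
        using that B_carrier by (intro index_finsum_vec) auto
      also have "\<dots> = (\<Sum>i\<in>{1..L - 1}. \<Sum>u\<in>words \<Sigma> i. \<Sum>v\<in>words \<Sigma> (L - i). (z u \<otimes>\<^sub>v z v) $ c)"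
        unfolding beta using finite_words[OF alphabet] z_carrier c
        by (intro sum.cong refl kron_vec_finsum_index) auto
      also have "\<dots> = (\<Sum>t\<in>?I. ?h t $ c)"
        using finite_words[OF alphabet]
        by (simp add: sum.Sigma sum.cartesian_product split_def)
      finally show ?thesis .
    qed
    fix p assume "p < dim_vec (K *\<^sub>v ?V)"
    then have p: "p < n * q" by (simp add: K_dim)
    then obtain a b where ab: "a < n" "b < q" and p_eq: "p = a * q + b"
      by (rule less_mult_split)
    have kron_p: "(v \<otimes>\<^sub>v w) $ p = v $ a * w $ b" if "dim_vec v = n" "dim_vec w = q" for v w :: "real vec"
      using ab that kron_vec_index[of a v b w] by (simp add: p_eq)
    have "beta_product \<Sigma> n R n' A' L $ p = (\<Sum>w\<in>words \<Sigma> L. z w $ p)"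
      unfolding beta using p z_carrier finite_words[OF alphabet] by (intro index_finsum_vec) auto
    \<comment> \<open>Word by word, the tree recursion is applied to the grammar factor in row
      \<open>a\<close>, while the matrix factor in row \<open>b\<close> is carried along.\<close>
    also have "\<dots> = (\<Sum>w\<in>words \<Sigma> L. \<Sum>i = 1..L - 1. (K *\<^sub>v (z (take i w) \<otimes>\<^sub>v z (drop i w))) $ p)"
    proof (intro sum.cong refl)
      fix w assume "w \<in> words \<Sigma> L"
      then have w: "w \<in> lists \<Sigma>" "length w = L" by (auto simp: words_def)
      then have parts: "take i w \<in> lists \<Sigma>" "drop i w \<in> lists \<Sigma>" for i
        by (auto dest: in_set_takeD in_set_dropD)
      have "z w $ p = x w $ a * y w $ b"
        unfolding z_def using w by (intro kron_p dim_x dim_y)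
      also have "x w $ a = (\<Sum>i = 1..L - 1. (M *\<^sub>v (x (take i w) \<otimes>\<^sub>v x (drop i w))) $ a)"
        using tree_count_vec_split[OF R, where w = w and i = a] w L ab by (simp only: x_def M_def)
      also have "\<dots> * y w $ b = (\<Sum>i = 1..L - 1. (M *\<^sub>v (x (take i w) \<otimes>\<^sub>v x (drop i w))) $ a * y w $ b)"
        by (rule sum_distrib_right)
      also have "\<dots> = (\<Sum>i = 1..L - 1. (K *\<^sub>v (z (take i w) \<otimes>\<^sub>v z (drop i w))) $ p)"
        \<comment> \<open>Here \<open>take i w @ drop i w\<close> is \<open>w\<close>, so the second
          factor in \<open>K_kron\<close> is \<open>y w\<close> for every \<open>i\<close>.\<close>
        using K_kron[OF parts(1) parts(2), of i i for i] kron_p[OF _ dim_y[OF w(1)]] dim_M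
        by (intro sum.cong refl) (simp del: index_mult_mat_vec)
      finally show "z w $ p = (\<Sum>i = 1..L - 1. (K *\<^sub>v (z (take i w) \<otimes>\<^sub>v z (drop i w))) $ p)" .
    qed
    also have "\<dots> = (\<Sum>i = 1..L - 1. \<Sum>w\<in>words \<Sigma> L. (K *\<^sub>v (z (take i w) \<otimes>\<^sub>v z (drop i w))) $ p)"
      by (rule sum.swap)
    \<comment> \<open>With the cut position now outermost, the two parts of \<open>w\<close> range
      independently over all words of lengths \<open>i\<close> and \<open>L - i\<close>.\<close>
    also have "\<dots> = (\<Sum>i = 1..L - 1. \<Sum>u\<in>words \<Sigma> i. \<Sum>v\<in>words \<Sigma> (L - i). (K *\<^sub>v (z u \<otimes>\<^sub>v z v)) $ p)"
      by (intro sum.cong refl sum_words_split) auto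
    also have "\<dots> = (\<Sum>t\<in>?I. (K *\<^sub>v ?h t) $ p)"
      using finite_words[OF alphabet]
      by (simp add: sum.Sigma sum.cartesian_product split_def del: index_mult_mat_vec)
    also have "\<dots> = (K *\<^sub>v ?V) $ p"
      using p V dim_finsum_vec[OF B_carrier] z_carrier
      by (intro index_mult_mat_vec_sum[symmetric])
        (auto simp: K_dim dim_z)
    finally show "beta_product \<Sigma> n R n' A' L $ p = (K *\<^sub>v ?V) $ p" .
  qed (simp add: beta_dim K_dim)
  ultimately show ?thesis
    unfolding K_def M_def N(2) q_def by blast
qed

end
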